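(* There exists a balanced group divisible triangle design $(V,\mathcal{G},\mathcal{B})$ of order $12$ with groups of dimension $6$ over $\mathbb{F}_2$, where $V=\mathbb{F}_{2^{12}}$, $\mathcal{G}$ is the set of all $65$ one-dimensional $\mathbb{F}_{2^6}$-subspaces of $V$ (each a $6$-dimensional $\mathbb{F}_2$-subspace; i.e. the Desarguesian spread), and $\mathcal{B}$ is invariant under multiplication by elements of $\mathbb{F}_{2^{12}}^*$.
   Context: For a vector space $V$ over $\mathbb{F}_q$, a triangle is a set $\{\langle a,b\rangle,\langle b,c\rangle,\langle c,a\rangle\}$ of three $2$-dimensional subspaces, with $a,b,c$ linearly independent. For $m\mid n$, a group divisible triangle design of order $n$ with groups of dimension $m$ over $\mathbb{F}_q$ is a triple $(V,\mathcal{G},\mathcal{B})$: $V$ an $n$-dimensional $\mathbb{F}_q$-space, $\mathcal{G}$ a set of $m$-dimensional subspaces such that every nonzero vector lies in exactly one, and $\mathcal{B}$ a set of triangles such that every $2$-dimensional subspace either belongs to exactly one triangle of $\mathcal{B}$ and to no group, or to no triangle and to one group. A triangle covers a nonzero vector $x$ if $x$ lies in one of its three subspaces; the design is balanced if all nonzero vectors are covered by the same number of triangles of $\mathcal{B}$. *)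

theory Defs
  imports Complex_Main "HOL-Library.Z2" "HOL-Library.Cardinality"
begin

instance bit :: finite
proof
  have "(UNIV :: bit set) = {0, 1}"
    using bit_not_zero_iff by blast
  thus "finite (UNIV :: bit set)"
    by (metis finite.emptyI finite.insertI)
qed

context vector_space
begin

definition is_triangle :: "'b set set \<Rightarrow> bool" where
  "is_triangle T \<longleftrightarrow>
     (\<exists>a b c. distinct [a, b, c] \<and> independent {a, b, c} \<and>
        T = {span {a, b}, span {b, c}, span {c, a}})"

end

text \<open>
  The ambient space is the whole type \<open>'v\<close>, which has finite dimension because the type
  is finite; the field of scalars is the finite field \<open>'k\<close>.
\<close>

locale group_divisible_triangle_design = vector_space scale
  for scale :: "'k::{field, finite} \<Rightarrow> 'v::{ab_group_add, finite} \<Rightarrow> 'v" +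
  fixes n m :: nat
    and \<G> :: "'v set set"
    and \<B> :: "'v set set set"
  assumes dvd: "m dvd n"
    and order: "dim (UNIV :: 'v set) = n"
    and groups: "W \<in> \<G> \<Longrightarrow> subspace W \<and> dim W = m"
    and partition: "x \<noteq> 0 \<Longrightarrow> \<exists>!W. W \<in> \<G> \<and> x \<in> W"
    and blocks: "T \<in> \<B> \<Longrightarrow> is_triangle T"
    and design: "subspace U \<Longrightarrow> dim U = 2 \<Longrightarrow>
      (\<exists>!T. T \<in> \<B> \<and> U \<in> T) \<and> (\<nexists>W. W \<in> \<G> \<and> U \<subseteq> W) \<or>
      (\<nexists>T. T \<in> \<B> \<and> U \<in> T) \<and> (\<exists>!W. W \<in> \<G> \<and> U \<subseteq> W)"

definition covers :: "'v set set \<Rightarrow> 'v \<Rightarrow> bool" where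
  "covers T x \<longleftrightarrow> (\<exists>U\<in>T. x \<in> U)"

locale balanced_group_divisible_triangle_design = group_divisible_triangle_design +
  assumes balanced:
    "x \<noteq> 0 \<Longrightarrow> y \<noteq> 0 \<Longrightarrow> card {T \<in> \<B>. covers T x} = card {T \<in> \<B>. covers T y}"

text \<open>
  A field of characteristic 2 as a vector space over its prime field.
\<close>

definition F2_scale :: "bit \<Rightarrow> 'a::field \<Rightarrow> 'a" where
  "F2_scale c x = (if c = 1 then x else 0)"

lemma vector_space_F2_scale:
  assumes "(2 :: 'a::field) = 0"
  shows "vector_space (F2_scale :: bit \<Rightarrow> 'a \<Rightarrow> 'a)"
proof
  have double: "x + x = 0" for x :: 'a
    using assms by (metis mult_2 mult_zero_left)
  fix a b :: bit and x y :: 'a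
  show "F2_scale (a + b) x = F2_scale a x + F2_scale b x"
    by (cases a; cases b) (auto simp: F2_scale_def double)
qed (auto simp: F2_scale_def)

definition is_subfield :: "'a::field set \<Rightarrow> bool" where
  "is_subfield K \<longleftrightarrow> 0 \<in> K \<and> 1 \<in> K \<and>
     (\<forall>x\<in>K. \<forall>y\<in>K. x - y \<in> K \<and> x * y \<in> K) \<and> (\<forall>x\<in>K. inverse x \<in> K)"

text \<open>
  The one-dimensional \<open>K\<close>-subspaces of \<open>'a\<close>, that is, the \<open>K\<close>-spans of single nonzero
  vectors.
\<close>

definition one_dim_subspaces :: "'a::field set \<Rightarrow> 'a set set" where
  "one_dim_subspaces K = {{c * v | c. c \<in> K} | v. v \<noteq> 0}"

definition mult_triangle :: "'a::field \<Rightarrow> 'a set set \<Rightarrow> 'a set set" where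
  "mult_triangle u T = (\<lambda>U. (\<lambda>x. u * x) ` U) ` T"

end

theory Submission
  imports Defs "HOL-Library.Code_Binary_Nat" "HOL-Computational_Algebra.Polynomial"
begin

text \<open>
  Call the 2-dimensional subspaces lines. The orbit of a line \<open>U\<close> under multiplication by nonzero
  scalars is determined by any one of the six ratios \<open>y / x\<close> of distinct nonzero \<open>x, y \<in> U\<close>, and \<open>U\<close>
  lies in a group if and only if these ratios lie in \<open>K\<close>; otherwise no scalar other than \<open>1\<close> fixes
  \<open>U\<close>. Hence the multiples of a family of base triangles form the required design as soon as the
  ratio sets of their lines partition the complement of \<open>K\<close>. Balance is automatic because the
  multiplicative group is transitive on nonzero vectors.

  A root \<open>g\<close> of \<open>x\<^sup>1\<^sup>2 + x\<^sup>6 + x\<^sup>4 + x + 1\<close> generates the multiplicative group, and \<open>g\<^sup>n \<in> K\<close> if and only if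
  \<open>65\<close> divides \<open>n\<close>. With respect to \<open>g\<close>, an explicit family of 224 base triangles, invariant under
  \<open>x \<mapsto> x\<^sup>8\<close>, has ratios whose 4032 exponents are exactly the numbers below 4095 that are not
  divisible by 65.
\<close>

section \<open>Lines, ratios and multiples of triangles\<close>

text \<open>Multiplication by \<open>x\<close> permutes \<open>S\<close>, so the product over
  \<open>S\<close> absorbs the factor \<open>x ^ card S\<close>. It serves for the nonzero elements
  of the field and of \<open>K\<close>.\<close>

lemma power_card_eq_1:
  fixes S :: "'f::field set"
  assumes "finite S" "0 \<notin> S" "x \<noteq> 0" "\<And>y. y \<in> S \<Longrightarrow> x * y \<in> S"
  shows "x ^ card S = 1"
proof -
  have inj: "inj_on ((*) x) S"
    using assms(3) by (simp add: inj_on_def)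
  have "(*) x ` S = S"
    using assms(1,4) inj by (intro endo_inj_surj) auto
  then have "bij_betw ((*) x) S S"
    using inj by (simp add: bij_betw_def)
  then have "(\<Prod>y\<in>S. x * y) = \<Prod>S"
    using prod.reindex_bij_betw[of "(*) x" S S "\<lambda>y. y"] by simp
  moreover have "\<Prod>S \<noteq> 0"
    using assms(1,2) by simp
  ultimately show ?thesis
    by (simp add: prod.distrib)
qed

text \<open>Translation by 1 permutes the ring, so the sum of all elements is unchanged when 1 is
  added to each. This yields characteristic 2 from the cardinality alone.\<close>

lemma of_nat_card_eq_0: "of_nat CARD('a::{ring_1, finite}) = (0::'a)"
proof -
  have "bij_betw (\<lambda>x::'a. x + 1) UNIV UNIV"
    by (rule bij_betw_byWitness[where f' = "\<lambda>x. x - 1"]) auto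
  then have "(\<Sum>x::'a\<in>UNIV. x + 1) = (\<Sum>x\<in>UNIV. x)"
    using sum.reindex_bij_betw[of "\<lambda>x::'a. x + 1" UNIV UNIV "\<lambda>x. x"] by simp
  then show ?thesis
    by (simp add: sum.distrib)
qed

definition ratios :: "'f::field set \<Rightarrow> 'f set" where
  "ratios U = {y / x | x y. x \<in> U \<and> y \<in> U \<and> x \<noteq> 0 \<and> y \<noteq> 0 \<and> x \<noteq> y}"

lemma ratios_mult:
  assumes "u \<noteq> 0"
  shows "ratios ((*) u ` U) = ratios U"
proof (intro set_eqI iffI)
  fix r assume "r \<in> ratios U"
  then obtain x y where "r = y / x" "x \<in> U" "y \<in> U" "x \<noteq> 0" "y \<noteq> 0" "x \<noteq> y"
    unfolding ratios_def by blast
  with assms have "r = (u * y) / (u * x)" "u * x \<in> (*) u ` U" "u * y \<in> (*) u ` U"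
     "u * x \<noteq> 0" "u * y \<noteq> 0" "u * x \<noteq> u * y" by auto
  then show "r \<in> ratios ((*) u ` U)"
    unfolding ratios_def by blast
next
  fix r assume "r \<in> ratios ((*) u ` U)"
  then obtain x y where "x \<in> U" "y \<in> U" "u * x \<noteq> 0" "u * y \<noteq> 0" "u * x \<noteq> u * y" "r = (u * y) / (u * x)"
    unfolding ratios_def by blast
  with assms have "r = y / x" "x \<in> U" "y \<in> U" "x \<noteq> 0" "y \<noteq> 0" "x \<noteq> y" by auto
  then show "r \<in> ratios U"
    unfolding ratios_def by blast
qed

lemma mult_triangle_mult_triangle:
  "mult_triangle u (mult_triangle v T) = mult_triangle (u * v) T"
  by (auto simp: mult_triangle_def image_image mult.assoc)

lemma mult_triangle_1: "mult_triangle 1 T = T"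
  by (simp add: mult_triangle_def)

lemma covers_mult_triangle:
  assumes "u \<noteq> (0 :: 'f::field)"
  shows "covers (mult_triangle u T) (u * x) \<longleftrightarrow> covers T x"
  using assms by (auto simp: covers_def mult_triangle_def)

section \<open>The field with 4096 elements as a vector space over its prime field\<close>

locale field_4096 =
  fixes K :: "'f::{field, finite} set"
  assumes card_field: "CARD('f) = 2 ^ 12"
    and subfield: "is_subfield K"
    and card_K: "card K = 2 ^ 6"
begin

lemma two_eq_0 [simp]: "(2::'f) = 0"
proof -
  have "(2::'f) ^ 12 = 0"
    using of_nat_card_eq_0[where 'a = 'f] unfolding card_field of_nat_power of_nat_numeral .
  then show ?thesis by (metis power_not_zero)
qed

sublocale vector_space "F2_scale :: bit \<Rightarrow> 'f \<Rightarrow> 'f"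
  by (rule vector_space_F2_scale[OF two_eq_0])

lemma add_self [simp]: "x + x = (0::'f)"
  using two_eq_0 by (metis mult_2 mult_zero_left)

lemma uminus_eq [simp]: "- x = (x::'f)"
  by (metis add_self minus_unique)

lemma diff_eq [simp]: "x - y = x + (y::'f)"
  by (metis add_uminus_conv_diff uminus_eq)

lemma add_eq_0_iff_eq: "x + y = 0 \<longleftrightarrow> x = (y::'f)"
  by (metis diff_eq right_minus_eq)

lemma add_add_cancel [simp]: "x + (x + y) = (y::'f)"
  by (simp flip: add.assoc)

lemma ex_bit: "(\<exists>k::bit. P k) \<longleftrightarrow> P 0 \<or> P 1"
  by (metis bit_not_zero_iff)

lemma subspace_iff: "subspace S \<longleftrightarrow> 0 \<in> S \<and> (\<forall>x\<in>S. \<forall>y\<in>S. x + y \<in> S)"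
  by (auto simp: subspace_def F2_scale_def)

lemma span_insert_iff: "x \<in> span (insert a S) \<longleftrightarrow> x \<in> span S \<or> x + a \<in> span S"
  by (simp add: span_breakdown_eq ex_bit F2_scale_def)

lemma add_eq_iff: "x + y = z \<longleftrightarrow> x = z + (y::'f)"
  by (metis add.commute add_add_cancel)

lemma span_pair: "span {a, b} = {0, a, b, a + b}"
  by (rule set_eqI) (auto simp: span_insert_iff add_eq_iff)

text \<open>A new independent vector \<open>a\<close> doubles the span: the coset
  \<open>a + span B\<close> is disjoint from \<open>span B\<close>.\<close>

lemma card_span:
  assumes "independent B"
  shows "card (span B) = 2 ^ card B"
proof -
  have "finite B" by simp
  then show ?thesis using assms
  proof (induction B rule: finite_induct)
    case (insert a B)
    have a: "a \<notin> span B" and B: "independent B"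
      using insert.prems insert.hyps by (auto simp: independent_insert)
    have "span (insert a B) = span B \<union> (+) a ` span B"
    proof (intro set_eqI iffI)
      fix x assume "x \<in> span (insert a B)"
      then show "x \<in> span B \<union> (+) a ` span B"
        by (auto simp: span_insert_iff image_iff) (metis add.commute add_add_cancel)
    qed (auto simp: span_insert_iff add.commute add.left_commute)
    moreover have "span B \<inter> (+) a ` span B = {}"
      using a by (auto) (metis add.commute add_add_cancel span_add)
    moreover have "card ((+) a ` span B) = card (span B)"
      by (intro card_image) (auto simp: inj_on_def)
    ultimately show ?case
      using insert B by (simp add: card_Un_disjoint)
  qed simp
qed

lemma card_subspace:
  assumes "subspace S"
  shows "card S = 2 ^ dim S"
proof -
  obtain B where B: "B \<subseteq> S" "independent B" "S \<subseteq> span B" "card B = dim S"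
    using basis_exists by blast
  then have "span B = S"
    using assms span_minimal by blast
  with card_span[OF B(2)] B(4) show ?thesis by simp
qed

lemma dim_eqI: "subspace S \<Longrightarrow> card S = 2 ^ n \<Longrightarrow> dim S = n"
  by (simp add: card_subspace)

lemma dim_2E:
  assumes "subspace U" "dim U = 2"
  obtains x y where "x \<noteq> 0" "y \<noteq> 0" "x \<noteq> y" "U = {0, x, y, x + y}"
proof -
  obtain B where B: "B \<subseteq> U" "independent B" "U \<subseteq> span B" "card B = dim U"
    using basis_exists by blast
  then obtain x y where xy: "B = {x, y}" "x \<noteq> y"
    using assms(2) by (metis card_2_iff)
  have "U = span B"
    using B assms span_minimal by blast
  moreover have "x \<noteq> 0" "y \<noteq> 0"
    using B(2) xy dependent_zero by auto
  ultimately show ?thesis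
    using that xy by (simp add: span_pair)
qed

lemma independent_tripleI:
  assumes "a \<noteq> 0" "b \<noteq> 0" "c \<noteq> 0" "a \<noteq> b" "b \<noteq> c" "c \<noteq> a" "a \<noteq> b + c"
  shows "independent {a, b, c}"
  using assms by (auto simp: independent_insert span_pair span_insert_iff add_eq_0_iff_eq)

lemma
  shows zero_in_K: "0 \<in> K" and one_in_K: "1 \<in> K"
    and add_in_K: "x \<in> K \<Longrightarrow> y \<in> K \<Longrightarrow> x + y \<in> K"
    and mult_in_K: "x \<in> K \<Longrightarrow> y \<in> K \<Longrightarrow> x * y \<in> K"
    and divide_in_K: "x \<in> K \<Longrightarrow> y \<in> K \<Longrightarrow> x / y \<in> K"
  using subfield unfolding is_subfield_def by (auto simp: divide_inverse)

section \<open>The subfield and its spread\<close>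

lemma power_63:
  assumes "x \<in> K" "x \<noteq> 0"
  shows "x ^ 63 = 1"
proof -
  have "card (K - {0}) = 63"
    using card_K zero_in_K by simp
  then show ?thesis
    using power_card_eq_1[of "K - {0}" x] assms by (simp add: mult_in_K)
qed

text \<open>The polynomial \<open>x ^ 63 - 1\<close> has at most 63 roots, and the 63 nonzero
  elements of \<open>K\<close> already are roots.\<close>

lemma in_K_if_power_63:
  assumes "x ^ 63 = 1"
  shows "x \<in> K"
proof -
  let ?p = "monom 1 63 - 1 :: 'f poly"
  have p: "poly ?p y = y ^ 63 - 1" for y
    by (simp only: poly_diff poly_monom poly_1 mult_1)
  have "coeff ?p 63 = 1"
    by (simp only: coeff_diff coeff_monom coeff_1) simp
  then have "?p \<noteq> 0"
    by (metis coeff_0 zero_neq_one)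
  have "degree ?p \<le> 63"
    by (intro degree_diff_le) (auto simp: degree_monom_le)
  then have "card {y. poly ?p y = 0} \<le> 63"
    using card_poly_roots_bound[OF \<open>?p \<noteq> 0\<close>] by linarith
  moreover have "card (K - {0}) = 63"
    using card_K zero_in_K by simp
  moreover have "K - {0} \<subseteq> {y. poly ?p y = 0}"
  proof
    fix y assume y: "y \<in> K - {0}"
    have "y ^ 63 = 1"
      using y power_63 by blast
    then show "y \<in> {y. poly ?p y = 0}"
      unfolding p mem_Collect_eq by simp
  qed
  ultimately have "K - {0} = {y. poly ?p y = 0}"
    by (intro card_seteq) auto
  moreover have "x \<in> {y. poly ?p y = 0}"
    unfolding p mem_Collect_eq by (simp only: assms right_minus_eq)
  ultimately show ?thesis by blast
qed

lemma one_dim_subspacesE: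
  assumes "W \<in> one_dim_subspaces K"
  obtains v where "v \<noteq> 0" "W = (\<lambda>c. c * v) ` K"
  using assms unfolding one_dim_subspaces_def by blast

lemma one_dim_subspacesI: "v \<noteq> 0 \<Longrightarrow> (\<lambda>c. c * v) ` K \<in> one_dim_subspaces K"
  unfolding one_dim_subspaces_def by blast

lemma card_one_dim_subspace:
  assumes "W \<in> one_dim_subspaces K"
  shows "card W = 2 ^ 6"
proof -
  obtain v where v: "v \<noteq> 0" "W = (\<lambda>c. c * v) ` K"
    using assms one_dim_subspacesE by blast
  then have "inj_on (\<lambda>c. c * v) K"
    by (auto simp: inj_on_def)
  then show ?thesis
    using v card_K by (simp add: card_image)
qed

lemma subspace_one_dim_subspace:
  assumes "W \<in> one_dim_subspaces K"
  shows "subspace W"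
proof -
  obtain v where v: "v \<noteq> 0" "W = (\<lambda>c. c * v) ` K"
    using assms one_dim_subspacesE by blast
  have "(\<lambda>c. c * v) a + (\<lambda>c. c * v) b \<in> (\<lambda>c. c * v) ` K" if "a \<in> K" "b \<in> K" for a b
    using add_in_K[OF that] by (auto simp: distrib_right[symmetric])
  then show ?thesis
    using zero_in_K v unfolding subspace_iff by (auto intro: rev_image_eqI)
qed

lemma one_dim_subspace_eq:
  assumes "W \<in> one_dim_subspaces K" "x \<in> W" "x \<noteq> 0"
  shows "W = (\<lambda>c. c * x) ` K"
proof -
  obtain v where v: "v \<noteq> 0" "W = (\<lambda>c. c * v) ` K"
    using assms one_dim_subspacesE by blast
  then obtain a where a: "a \<in> K" "x = a * v" "a \<noteq> 0"
    using assms by auto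
  show ?thesis
  proof (intro set_eqI iffI)
    fix y assume "y \<in> W"
    then obtain b where "b \<in> K" "y = b * v" using v by auto
    then have "y = (b / a) * x" "b / a \<in> K" using a divide_in_K by auto
    then show "y \<in> (\<lambda>c. c * x) ` K" by blast
  next
    fix y assume "y \<in> (\<lambda>c. c * x) ` K"
    then obtain b where "b \<in> K" "y = (b * a) * v" using a by (auto simp: mult.assoc)
    then show "y \<in> W" using v a mult_in_K by blast
  qed
qed

lemma ex1_one_dim_subspace:
  assumes "x \<noteq> 0"
  shows "\<exists>!W. W \<in> one_dim_subspaces K \<and> x \<in> W"
proof (rule ex1I[of _ "(\<lambda>c. c * x) ` K"])
  have "x \<in> (\<lambda>c. c * x) ` K"
    using one_in_K by (auto intro: rev_image_eqI)
  then show "(\<lambda>c. c * x) ` K \<in> one_dim_subspaces K \<and> x \<in> (\<lambda>c. c * x) ` K"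
    using one_dim_subspacesI[OF assms] by simp
qed (use one_dim_subspace_eq assms in blast)

text \<open>Without 0 the groups have 63 elements each and partition the 4095 = 63 * 65 nonzero
  vectors.\<close>

lemma card_one_dim_subspaces: "card (one_dim_subspaces K) = 65"
proof -
  let ?C = "(\<lambda>W. W - {0}) ` one_dim_subspaces K"
  have zero: "0 \<in> W" if "W \<in> one_dim_subspaces K" for W
    using subspace_one_dim_subspace[OF that] subspace_0 by blast
  have "inj_on (\<lambda>W. W - {0}) (one_dim_subspaces K)"
    by (rule inj_onI) (metis zero insert_Diff)
  then have card: "card ?C = card (one_dim_subspaces K)"
    by (rule card_image)
  have "63 * card ?C = card (\<Union>?C)"
  proof (rule card_partition)
    show "card c = 63" if "c \<in> ?C" for c
      using that zero card_one_dim_subspace by fastforce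
    show "c \<inter> d = {}" if "c \<in> ?C" "d \<in> ?C" "c \<noteq> d" for c d
      using that ex1_one_dim_subspace by blast
  qed auto
  moreover have "\<Union>?C = UNIV - {0}"
    using ex1_one_dim_subspace by blast
  ultimately have "63 * card ?C = 4095"
    using card_field by simp
  then show ?thesis using card by simp
qed

section \<open>Lines up to multiplication by scalars\<close>

lemma ratio_eq_image:
  assumes "subspace U" "dim U = 2" "x \<in> U" "x \<noteq> 0" "r * x \<in> U" "r \<noteq> 0" "r \<noteq> 1"
  shows "U = (*) x ` {0, 1, r, 1 + r}"
proof -
  have "r * x \<noteq> 0" "r * x \<noteq> x" using assms by auto
  then have "card {0, x, r * x, x + r * x} = 4"
    using assms(4) by (auto simp: add_eq_0_iff_eq)
  moreover have "card U = 4"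
    using card_subspace[OF assms(1)] assms(2) by simp
  moreover have "{0, x, r * x, x + r * x} \<subseteq> U"
    using assms(1,3,5) unfolding subspace_iff by simp
  ultimately have "U = {0, x, r * x, x + r * x}"
    by (metis card_subset_eq finite)
  then show ?thesis by (simp add: algebra_simps)
qed

text \<open>Two lines sharing a ratio \<open>r\<close> are thus multiples of the same line
  \<open>{0, 1, r, 1 + r}\<close>, hence of each other.\<close>

lemma ratiosE:
  assumes "subspace U" "dim U = 2" "r \<in> ratios U"
  obtains x where "x \<noteq> 0" "r \<noteq> 0" "r \<noteq> 1" "U = (*) x ` {0, 1, r, 1 + r}"
proof -
  obtain x y where "r = y / x" "x \<in> U" "y \<in> U" "x \<noteq> 0" "y \<noteq> 0" "x \<noteq> y"
    using assms unfolding ratios_def by blast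
  then show ?thesis
    using that[of x] ratio_eq_image[OF assms(1,2), of x r] by auto
qed

text \<open>The only group through the point \<open>x\<close> of \<open>U\<close> is the set of
  \<open>K\<close>-multiples of \<open>x\<close>, and it contains \<open>x * r\<close> exactly if
  \<open>r\<close> lies in \<open>K\<close>.\<close>

lemma ratio_in_K_iff:
  assumes "subspace U" "dim U = 2" "r \<in> ratios U"
  shows "r \<in> K \<longleftrightarrow> (\<exists>W. W \<in> one_dim_subspaces K \<and> U \<subseteq> W)"
proof -
  obtain x where x: "x \<noteq> 0" "r \<noteq> 0" "U = (*) x ` {0, 1, r, 1 + r}"
    using assms ratiosE by blast
  show ?thesis
  proof
    assume "r \<in> K"
    then have "{0, 1, r, 1 + r} \<subseteq> K"
      using zero_in_K one_in_K add_in_K by simp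
    then have "U \<subseteq> (\<lambda>c. c * x) ` K"
      unfolding x(3) by (auto simp: mult.commute)
    then show "\<exists>W. W \<in> one_dim_subspaces K \<and> U \<subseteq> W"
      using one_dim_subspacesI[OF x(1)] by blast
  next
    assume "\<exists>W. W \<in> one_dim_subspaces K \<and> U \<subseteq> W"
    then obtain W where W: "W \<in> one_dim_subspaces K" "U \<subseteq> W" by blast
    then have "x \<in> W" "x * r \<in> W" using x by auto
    then show "r \<in> K"
      using one_dim_subspace_eq[OF W(1) \<open>x \<in> W\<close> x(1)] x(1) by (auto simp: mult.commute)
  qed
qed

text \<open>
  A multiplier fixing a line and moving its points permutes its three points cyclically, hence
  has order 3 and lies in \<^term>\<open>K\<close>.
\<close>

lemma line_stabilizer:
  assumes "subspace U" "dim U = 2" "ratios U \<inter> K = {}" "u \<noteq> 0" "(*) u ` U = U"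
  shows "u = 1"
proof (rule ccontr)
  assume "u \<noteq> 1"
  obtain x where x: "x \<in> U" "x \<noteq> 0"
    using assms(1,2) dim_2E by blast
  have ux: "u * x \<in> U" and uux: "u * (u * x) \<in> U"
    using x assms(5) by blast+
  then have "u \<in> ratios U"
    using x \<open>u \<noteq> 1\<close> assms(4) unfolding ratios_def
    by (intro CollectI exI[of _ x] exI[of _ "u * x"]) auto
  have "U = (*) x ` {0, 1, u, 1 + u}"
    using ratio_eq_image[OF assms(1,2) x ux assms(4) \<open>u \<noteq> 1\<close>] .
  then have "u * (u * x) \<in> (*) x ` {0, 1, u, 1 + u}"
    using uux by simp
  then have "u * u \<in> {0, 1, u, 1 + u}"
    using x(2) by auto
  moreover have "u * u \<noteq> 1"
  proof
    assume "u * u = 1"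
    then have "(u - 1) * (u - 1) = 0"
      by (simp add: algebra_simps)
    then show False using \<open>u \<noteq> 1\<close> by (simp add: add_eq_0_iff_eq)
  qed
  ultimately have "u * u = 1 + u"
    using assms(4) \<open>u \<noteq> 1\<close> by auto
  then have "u ^ 3 = 1"
    by (simp add: power3_eq_cube algebra_simps)
  then have "(u ^ 3) ^ 21 = 1" by simp
  then have "u ^ 63 = 1" by (simp flip: power_mult)
  then show False
    using in_K_if_power_63 \<open>u \<in> ratios U\<close> assms(3) by blast
qed

lemma triangle_line:
  assumes "is_triangle T" "U \<in> T"
  shows "subspace U \<and> dim U = 2"
proof -
  obtain a b c where abc: "distinct [a, b, c]" "independent {a, b, c}"
    "T = {span {a, b}, span {b, c}, span {c, a}}"
    using assms(1) unfolding is_triangle_def by blast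
  then obtain x y where xy: "U = span {x, y}" "{x, y} \<subseteq> {a, b, c}" "x \<noteq> y"
    using assms(2) by auto
  then have "independent {x, y}"
    using abc(2) independent_mono by blast
  then have "dim (span {x, y}) = card {x, y}"
    by (rule dim_span_eq_card_independent)
  then show ?thesis
    using xy by simp
qed

lemma mult_triangle_is_triangle:
  assumes "is_triangle T" "u \<noteq> 0"
  shows "is_triangle (mult_triangle u T)"
proof -
  obtain a b c where abc: "distinct [a, b, c]" "independent {a, b, c}"
    "T = {span {a, b}, span {b, c}, span {c, a}}"
    using assms(1) unfolding is_triangle_def by blast
  have "Vector_Spaces.linear F2_scale F2_scale ((*) u)"
    by unfold_locales (auto simp: F2_scale_def algebra_simps)
  then interpret l: Vector_Spaces.linear F2_scale F2_scale "(*) u" .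
  have "independent ((*) u ` {a, b, c})"
    using abc(2) assms(2) by (intro l.independent_injective_image) (auto simp: inj_on_def)
  moreover have "mult_triangle u T =
      {span {u * a, u * b}, span {u * b, u * c}, span {u * c, u * a}}"
    unfolding mult_triangle_def abc(3) by (simp add: span_pair distrib_left)
  ultimately show ?thesis
    using abc(1) assms(2) unfolding is_triangle_def
    by (intro exI[of _ "u * a"] exI[of _ "u * b"] exI[of _ "u * c"]) simp
qed

section \<open>Orbits of base triangles and the design criterion\<close>

definition translates :: "'f set set set \<Rightarrow> 'f set set set" where
  "translates \<T> = {mult_triangle u T | u T. u \<noteq> 0 \<and> T \<in> \<T>}"

lemma mem_translatesI: "u \<noteq> 0 \<Longrightarrow> T \<in> \<T> \<Longrightarrow> mult_triangle u T \<in> translates \<T>"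
  unfolding translates_def by blast

lemma mem_translatesE:
  assumes "S \<in> translates \<T>" "U \<in> S"
  obtains u T L where "u \<noteq> 0" "T \<in> \<T>" "S = mult_triangle u T" "L \<in> T" "U = (*) u ` L"
  using assms unfolding translates_def mult_triangle_def by blast

lemma mult_triangle_translates:
  assumes "u \<noteq> 0"
  shows "mult_triangle u ` translates \<T> = translates \<T>"
proof (intro set_eqI iffI)
  fix T assume "T \<in> translates \<T>"
  then obtain v T' where v: "v \<noteq> 0" "T' \<in> \<T>" "T = mult_triangle v T'"
    unfolding translates_def by blast
  then have "T = mult_triangle u (mult_triangle (v / u) T')"
    using assms by (simp add: mult_triangle_mult_triangle)
  moreover have "mult_triangle (v / u) T' \<in> translates \<T>"
    unfolding translates_def using v assms by (auto intro!: exI[of _ "v / u"])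
  ultimately show "T \<in> mult_triangle u ` translates \<T>" by blast
next
  fix T assume "T \<in> mult_triangle u ` translates \<T>"
  then obtain v T' where "v \<noteq> 0" "T' \<in> \<T>" "T = mult_triangle u (mult_triangle v T')"
    unfolding translates_def by blast
  then show "T \<in> translates \<T>"
    unfolding translates_def using assms
    by (auto simp: mult_triangle_mult_triangle intro!: exI[of _ "u * v"])
qed

text \<open>For a line outside all groups, \<open>cover\<close> supplies a triangle containing it,
  \<open>unique\<close> determines the base line it comes from, and \<open>line_stabilizer\<close>
  determines the multiplier.\<close>

lemma balanced_design_translates:
  assumes triangle: "\<And>T. T \<in> \<T> \<Longrightarrow> is_triangle T"
    and line: "\<And>T U. T \<in> \<T> \<Longrightarrow> U \<in> T \<Longrightarrow> subspace U \<and> dim U = 2 \<and> ratios U \<inter> K = {}"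
    and cover: "\<And>r. r \<notin> K \<Longrightarrow> \<exists>T\<in>\<T>. \<exists>U\<in>T. r \<in> ratios U"
    and unique: "\<And>r T U T' U'. T \<in> \<T> \<Longrightarrow> U \<in> T \<Longrightarrow> T' \<in> \<T> \<Longrightarrow> U' \<in> T' \<Longrightarrow>
      r \<in> ratios U \<Longrightarrow> r \<in> ratios U' \<Longrightarrow> T = T' \<and> U = U'"
  shows "balanced_group_divisible_triangle_design F2_scale 12 6 (one_dim_subspaces K) (translates \<T>)"
proof
  show "(6::nat) dvd 12" by simp
  show "dim (UNIV :: 'f set) = 12"
    using card_field by (intro dim_eqI) auto
  show "subspace W \<and> dim W = 6" if "W \<in> one_dim_subspaces K" for W
    using subspace_one_dim_subspace[OF that] card_one_dim_subspace[OF that] dim_eqI by blast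
  show "\<exists>!W. W \<in> one_dim_subspaces K \<and> x \<in> W" if "x \<noteq> 0" for x
    using ex1_one_dim_subspace[OF that] .
  show "is_triangle T" if "T \<in> translates \<T>" for T
    using that triangle mult_triangle_is_triangle unfolding translates_def by blast
next
  fix U :: "'f set" assume U: "subspace U" "dim U = 2"
  then obtain x y where xy: "x \<noteq> 0" "y \<noteq> 0" "x \<noteq> y" "U = {0, x, y, x + y}"
    by (rule dim_2E)
  then have r: "y / x \<in> ratios U"
    unfolding ratios_def by blast
  have ratio_line: "y / x \<in> ratios L" if "U = (*) u ` L" "u \<noteq> 0" for u L
    using r that by (simp add: ratios_mult)
  show "(\<exists>!T. T \<in> translates \<T> \<and> U \<in> T) \<and> (\<nexists>W. W \<in> one_dim_subspaces K \<and> U \<subseteq> W) \<or>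
      (\<nexists>T. T \<in> translates \<T> \<and> U \<in> T) \<and> (\<exists>!W. W \<in> one_dim_subspaces K \<and> U \<subseteq> W)"
  proof (cases "y / x \<in> K")
    case True
    have "\<nexists>T. T \<in> translates \<T> \<and> U \<in> T"
    proof
      assume "\<exists>T. T \<in> translates \<T> \<and> U \<in> T"
      then obtain T where "T \<in> translates \<T>" "U \<in> T" by blast
      then obtain u T' L where "u \<noteq> 0" "T' \<in> \<T>" "L \<in> T'" "U = (*) u ` L"
        by (rule mem_translatesE)
      then show False
        using True line ratio_line by blast
    qed
    moreover have "\<exists>!W. W \<in> one_dim_subspaces K \<and> U \<subseteq> W"
    proof -
      have "x \<in> U" using xy(4) by simp
      then show ?thesis
        using True ratio_in_K_iff[OF U r] ex1_one_dim_subspace[OF xy(1)] by (metis subsetD)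
    qed
    ultimately show ?thesis by blast
  next
    case False
    then obtain T L where TL: "T \<in> \<T>" "L \<in> T" "y / x \<in> ratios L"
      using cover by blast
    then have L: "subspace L" "dim L = 2"
      using line by blast+
    obtain v where v: "v \<noteq> 0" "L = (*) v ` {0, 1, y / x, 1 + y / x}"
      using ratiosE[OF L TL(3)] by blast
    obtain w where w: "w \<noteq> 0" "U = (*) w ` {0, 1, y / x, 1 + y / x}"
      using ratiosE[OF U r] by blast
    have "U = (*) (w / v) ` L"
      unfolding w(2) v(2) image_image using v(1) by simp
    then have "U \<in> mult_triangle (w / v) T"
      unfolding mult_triangle_def using TL(2) by blast
    moreover have "mult_triangle (w / v) T \<in> translates \<T>"
      using TL(1) v(1) w(1) by (intro mem_translatesI) auto
    moreover have "S = S'" if "S \<in> translates \<T>" "U \<in> S" "S' \<in> translates \<T>" "U \<in> S'" for S S'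
    proof -
      obtain u T M where u: "u \<noteq> 0" "T \<in> \<T>" "S = mult_triangle u T" "M \<in> T" "U = (*) u ` M"
        using \<open>S \<in> translates \<T>\<close> \<open>U \<in> S\<close> by (rule mem_translatesE)
      obtain u' T' M' where u': "u' \<noteq> 0" "T' \<in> \<T>" "S' = mult_triangle u' T'" "M' \<in> T'" "U = (*) u' ` M'"
        using \<open>S' \<in> translates \<T>\<close> \<open>U \<in> S'\<close> by (rule mem_translatesE)
      have eq: "T = T'" "M = M'"
        using unique[OF u(2,4) u'(2,4) ratio_line[OF u(5,1)] ratio_line[OF u'(5,1)]] by auto
      \<comment> \<open>Both \<open>u\<close> and \<open>u'\<close> carry \<open>M\<close> to
        \<open>U\<close>, so their quotient stabilizes \<open>M\<close>.\<close>
      have "(*) (u / u') ` M = (*) (inverse u') ` U"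
        unfolding u(5) image_image by (simp add: field_simps)
      also have "\<dots> = M"
        unfolding u'(5) eq image_image using u'(1) by (simp flip: mult.assoc)
      finally have "u / u' = 1"
        using line[OF u(2,4)] u(1) u'(1) by (intro line_stabilizer[of M]) auto
      then show ?thesis
        using u u' eq by auto
    qed
    moreover have "\<nexists>W. W \<in> one_dim_subspaces K \<and> U \<subseteq> W"
      using False ratio_in_K_iff[OF U r] by blast
    ultimately show ?thesis by blast
  qed
next
  fix x y :: 'f assume xy: "x \<noteq> 0" "y \<noteq> 0"
  let ?B = "translates \<T>"
  \<comment> \<open>Multiplication by \<open>b / a\<close> moves \<open>a\<close> to
    \<open>b\<close> and preserves the set of blocks; multiplication by \<open>a / b\<close> is the
    inverse.\<close>
  have map: "mult_triangle (b / a) T \<in> {T \<in> ?B. covers T b}"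
    if "a \<noteq> 0" "b \<noteq> 0" "T \<in> {T \<in> ?B. covers T a}" for a b T
    using that covers_mult_triangle[of "b / a" T a] mult_triangle_translates[of "b / a" \<T>] by auto
  have "bij_betw (mult_triangle (y / x)) {T \<in> ?B. covers T x} {T \<in> ?B. covers T y}"
    using xy map by (intro bij_betw_byWitness[where f' = "mult_triangle (x / y)"])
      (auto simp: mult_triangle_mult_triangle mult_triangle_1)
  then show "card {T \<in> ?B. covers T x} = card {T \<in> ?B. covers T y}"
    by (rule bij_betw_same_card)
qed

end

section \<open>Arithmetic modulo a primitive polynomial\<close>

text \<open>
  Residues modulo \<open>x\<^sup>1\<^sup>2 + x\<^sup>6 + x\<^sup>4 + x + 1\<close> over the field with two elements, constant
  coefficient first.
\<close>

type_synonym bits12 = "bool \<times> bool \<times> bool \<times> bool \<times> bool \<times> bool \<times>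
  bool \<times> bool \<times> bool \<times> bool \<times> bool \<times> bool"

fun add_one :: "bits12 \<Rightarrow> bits12" where
  "add_one (a0, as) = (\<not> a0, as)"

text \<open>The overflow \<open>x ^ 12\<close> reduces to \<open>x ^ 6 + x ^ 4 + x + 1\<close>, so
  \<open>a11\<close> enters positions 0, 1, 4 and 6.\<close>

fun times_x :: "bits12 \<Rightarrow> bits12" where
  "times_x (a0, a1, a2, a3, a4, a5, a6, a7, a8, a9, a10, a11) =
     (a11, a0 \<noteq> a11, a1, a2, a3 \<noteq> a11, a4, a5 \<noteq> a11, a6, a7, a8, a9, a10)"

text \<open>In characteristic 2 squaring is additive and moves the coefficient of
  \<open>x ^ k\<close> to \<open>x ^ (2 * k)\<close>; those with \<open>k\<close> from 6 to 11 are
  then reduced.\<close>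

fun square :: "bits12 \<Rightarrow> bits12" where
  "square (a0, a1, a2, a3, a4, a5, a6, a7, a8, a9, a10, a11) =
     (a0 \<noteq> (a6 \<noteq> (a9 \<noteq> a10)),
      a6 \<noteq> (a9 \<noteq> a10),
      a1 \<noteq> (a7 \<noteq> (a10 \<noteq> a11)),
      a7 \<noteq> (a10 \<noteq> a11),
      a2 \<noteq> (a6 \<noteq> (a8 \<noteq> (a9 \<noteq> (a10 \<noteq> a11)))),
      a8 \<noteq> a11,
      a3 \<noteq> (a6 \<noteq> (a7 \<noteq> a11)),
      a9,
      a4 \<noteq> (a7 \<noteq> a8),
      a10,
      a5 \<noteq> (a8 \<noteq> a9),
      a11)"

fun power_bits :: "num \<Rightarrow> bits12" where
  "power_bits num.One =
     (False, True, False, False, False, False, False, False, False, False, False, False)"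
| "power_bits (num.Bit0 n) = square (power_bits n)"
| "power_bits (num.Bit1 n) = times_x (square (power_bits n))"

text \<open>The value \<open>0\<close> is excluded since \<^term>\<open>num_of_nat 0\<close> is \<^term>\<open>num.One\<close>.\<close>

definition zech :: "nat \<Rightarrow> nat \<Rightarrow> bool" where
  "zech e z \<longleftrightarrow> e \<noteq> 0 \<and> z \<noteq> 0 \<and> add_one (power_bits (num_of_nat e)) = power_bits (num_of_nat z)"

lemma numeral_num_of_nat: "n \<noteq> 0 \<Longrightarrow> numeral (num_of_nat n) = n"
  by (simp only: nat_of_num_numeral[symmetric] num_of_nat_inverse neq0_conv)

text \<open>The ring is arbitrary so that the same computation applies to a field element and to the
  indeterminate of a polynomial ring.\<close>

definition modulus :: "'a::comm_ring_1 \<Rightarrow> 'a" where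
  "modulus x = x ^ 12 + x ^ 6 + x ^ 4 + x + 1"

fun eval_bits :: "'a::comm_ring_1 \<Rightarrow> bits12 \<Rightarrow> 'a" where
  "eval_bits x (a0, a1, a2, a3, a4, a5, a6, a7, a8, a9, a10, a11) =
     of_bool a0 + of_bool a1 * x + of_bool a2 * x ^ 2 + of_bool a3 * x ^ 3 +
     of_bool a4 * x ^ 4 + of_bool a5 * x ^ 5 + of_bool a6 * x ^ 6 + of_bool a7 * x ^ 7 +
     of_bool a8 * x ^ 8 + of_bool a9 * x ^ 9 + of_bool a10 * x ^ 10 + of_bool a11 * x ^ 11"

section \<open>Correctness of the bit arithmetic in characteristic 2\<close>

context
  fixes x :: "'a::comm_ring_1"
  assumes two: "(2::'a) = 0"
begin

lemma char_2_simps: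
  "a + a = 0" "a + (a + b) = b" "- a = a" "a - b = a + b" for a b :: 'a
proof -
  show *: "a + a = 0" for a :: 'a
    using two by (metis mult_2 mult_zero_left)
  then show "a + (a + b) = b" by (simp flip: add.assoc)
  show **: "- a = a" for a :: 'a
    using *[of a] by (rule minus_unique)
  show "a - b = a + b"
    using **[of b] by (metis add_uminus_conv_diff)
qed

lemma of_bool_xor: "of_bool (a \<noteq> b) = (of_bool a + of_bool b :: 'a)"
  by (cases a; cases b) (simp_all add: char_2_simps)

lemma square_add: "(a + b) ^ 2 = a ^ 2 + (b ^ 2 :: 'a)"
  by (simp add: power2_sum two)

lemma eval_add_one: "eval_bits x (add_one as) = 1 + eval_bits x as"
proof (cases as rule: times_x.cases)
  case (1 a0 a1 a2 a3 a4 a5 a6 a7 a8 a9 a10 a11)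
  have "of_bool (\<not> a0) = 1 + (of_bool a0 :: 'a)"
    by (cases a0) (simp_all add: char_2_simps)
  then show ?thesis by (simp add: 1 add.assoc)
qed

lemma eval_times_x: "modulus x dvd x * eval_bits x as - eval_bits x (times_x as)"
proof (cases as rule: times_x.cases)
  case (1 a0 a1 a2 a3 a4 a5 a6 a7 a8 a9 a10 a11)
  have "x * eval_bits x as - eval_bits x (times_x as) = of_bool a11 * modulus x"
    unfolding 1 modulus_def times_x.simps eval_bits.simps of_bool_xor
    by (simp add: algebra_simps char_2_simps numeral_eq_Suc)
  then show ?thesis by simp
qed

lemma eval_square: "modulus x dvd eval_bits x as ^ 2 - eval_bits x (square as)"
proof (cases as rule: times_x.cases)
  case (1 a0 a1 a2 a3 a4 a5 a6 a7 a8 a9 a10 a11)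
  have sq: "(of_bool b * y) ^ 2 = of_bool b * y ^ 2" for b and y :: 'a
    by simp
  \<comment> \<open>The factor at each \<open>of_bool\<close> coefficient \<open>a6\<close> to
    \<open>a11\<close> is the quotient of the corresponding even power of \<open>x\<close> on
    division by the modulus.\<close>
  have "eval_bits x as ^ 2 - eval_bits x (square as) =
    modulus x * (of_bool a6 + of_bool a7 * x ^ 2 + of_bool a8 * x ^ 4 +
      of_bool a9 * (x ^ 6 + 1) + of_bool a10 * (x ^ 8 + x ^ 2 + 1) + of_bool a11 * (x ^ 10 + x ^ 4 + x ^ 2))"
    unfolding 1 modulus_def square.simps eval_bits.simps of_bool_xor square_add sq
    by (simp add: algebra_simps char_2_simps flip: power_mult power_add power_Suc)
  then show ?thesis by simp
qed

lemma eval_power_bits: "modulus x dvd x ^ numeral n - eval_bits x (power_bits n)"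
proof (induction n)
  case One
  then show ?case by simp
next
  case (Bit0 n)
  let ?e = "eval_bits x (power_bits n)"
  \<comment> \<open>With \<open>a\<close> the power and \<open>e\<close> its residue,
    \<open>a ^ 2 - e ^ 2\<close> factors, and the induction hypothesis divides
    \<open>a - e\<close>.\<close>
  have eq: "x ^ numeral (num.Bit0 n) - eval_bits x (square (power_bits n)) =
    (x ^ numeral n - ?e) * (x ^ numeral n + ?e) + (?e ^ 2 - eval_bits x (square (power_bits n)))"
    by (simp add: numeral_Bit0 power_add algebra_simps power2_eq_square)
  show ?case
    unfolding power_bits.simps eq by (intro dvd_add dvd_mult2 Bit0 eval_square)
next
  case (Bit1 n)
  let ?e = "eval_bits x (power_bits n)" and ?s = "square (power_bits n)"
  have eq: "x ^ numeral (num.Bit1 n) - eval_bits x (times_x ?s) =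
    x * ((x ^ numeral n - ?e) * (x ^ numeral n + ?e)) + x * (?e ^ 2 - eval_bits x ?s)
     + (x * eval_bits x ?s - eval_bits x (times_x ?s))"
    unfolding power_numeral_odd Let_def by (simp add: algebra_simps power2_eq_square)
  show ?case
    unfolding power_bits.simps eq
    by (intro dvd_add dvd_mult[OF dvd_mult2[OF Bit1]] dvd_mult[OF eval_square] eval_times_x)
qed

lemma zech_sound:
  assumes "modulus x = 0" "zech e z"
  shows "1 + x ^ e = x ^ z"
proof -
  have *: "x ^ n = eval_bits x (power_bits (num_of_nat n))" if "n \<noteq> 0" for n
    using eval_power_bits[of "num_of_nat n"] assms(1)
    unfolding numeral_num_of_nat[OF that] by simp
  show ?thesis
    using assms(2) * eval_add_one unfolding zech_def by metis
qed

end

section \<open>The base triangles\<close>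

text \<open>
  A code \<open>(i, j, p, q, r)\<close> stands for the triangle with vertices \<open>1\<close>, \<open>g\<^sup>i\<close>, \<open>g\<^sup>j\<close>; the other entries
  are the logarithms of \<open>1 + g\<^sup>i\<close>, \<open>1 + g\<^sup>j\<close> and \<open>1 + g\<^sup>j\<^sup>-\<^sup>i\<close>. The two tables, found by computer
  search, represent the orbits of lengths 4 and 2 under \<open>x \<mapsto> x\<^sup>8\<close>.
\<close>

type_synonym code = "nat \<times> nat \<times> nat \<times> nat \<times> nat"

definition base_long :: "code list" where
  "base_long = [
    (119, 1988, 987, 434, 1467), (21, 1127, 1585, 3544, 2304), (1316, 2140, 9, 3828, 2288),
    (429, 982, 1814, 976, 1152), (246, 858, 60, 3628, 3941), (314, 1187, 347, 1946, 2639),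
    (421, 1415, 3388, 1507, 217), (466, 1331, 2885, 1406, 1548), (7, 890, 2575, 2153, 1611),
    (28, 1077, 2110, 2727, 2590), (73, 1237, 2328, 927, 2084), (645, 1683, 35, 1274, 2387),
    (85, 718, 2466, 1443, 2259), (146, 1506, 561, 1174, 2601), (1173, 1788, 1099, 1361, 2748),
    (25, 1087, 1521, 1644, 1526), (17, 813, 755, 1731, 1720), (326, 1221, 375, 3773, 3118),
    (123, 2042, 30, 4005, 279), (1602, 2443, 1631, 1817, 4064), (23, 1912, 670, 1350, 3995),
    (1301, 1608, 4038, 2322, 87), (83, 423, 1754, 1266, 1674), (605, 1655, 838, 1515, 2022),
    (1, 1981, 2159, 2217, 3049), (1340, 2026, 46, 1925, 2203), (706, 1986, 2774, 2001, 3964),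
    (2, 1663, 223, 3484, 948), (127, 1041, 1178, 4081, 2192), (5, 946, 1999, 1289, 3846),
    (1952, 2840, 1964, 2058, 1693), (86, 1756, 3691, 4068, 3726), (39, 1204, 3023, 2388, 986),
    (1894, 2488, 3985, 2786, 2316), (1271, 1826, 82, 3688, 3405), (19, 181, 942, 270, 1831),
    (180, 1588, 169, 3365, 2938), (529, 2172, 583, 595, 2197), (1101, 1256, 4024, 1388, 1584),
    (81, 266, 2963, 944, 3561), (107, 840, 97, 3279, 921), (13, 398, 158, 860, 660),
    (692, 1501, 3834, 2678, 1108), (1681, 2023, 94, 1860, 1635), (1695, 2344, 53, 142, 2272),
    (1453, 1696, 1412, 1005, 1785), (4, 454, 446, 3759, 1697), (1794, 2247, 4028, 655, 1222),
    (124, 1927, 3488, 1125, 2297), (491, 897, 488, 2014, 1059)]"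

definition base_short :: "code list" where
  "base_short = [
    (63, 129, 1949, 758, 3467), (151, 1474, 716, 779, 2514), (1071, 2205, 113, 3800, 3557),
    (241, 1197, 2491, 1866, 675), (252, 1231, 3701, 1835, 2780), (316, 567, 26, 3826, 1915),
    (189, 819, 452, 3822, 2915), (206, 899, 572, 3848, 3369), (652, 778, 750, 2955, 3898),
    (265, 580, 767, 4043, 3505), (947, 1764, 4040, 3677, 1392), (1461, 1687, 4058, 2368, 2142)]"

text \<open>The map raising to the power \<open>m\<close> multiplies logarithms by \<open>m\<close>.
  For \<open>m\<close> a power of 2 it is additive, so it respects the logarithms of sums as
  well.\<close>

definition frobenius :: "nat \<Rightarrow> code \<Rightarrow> code" where
  "frobenius m = (\<lambda>(i, j, p, q, r).
     (m * i mod 4095, m * j mod 4095, m * p mod 4095, m * q mod 4095, m * r mod 4095))"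

text \<open>This makes 50 * 4 + 12 * 2 = 224 triangles.\<close>

definition base :: "code list" where
  "base = concat (map (\<lambda>m. map (frobenius m) base_long) [1, 8, 64, 512]) @
     concat (map (\<lambda>m. map (frobenius m) base_short) [1, 8])"

text \<open>
  An edge \<open>(s, e, z)\<close> stands for the line with nonzero points \<open>g\<^sup>s\<close>, \<open>g\<^sup>s\<^sup>+\<^sup>e\<close>, \<open>g\<^sup>s\<^sup>+\<^sup>z\<close>.
\<close>

definition edges :: "code \<Rightarrow> (nat \<times> nat \<times> nat) list" where
  "edges = (\<lambda>(i, j, p, q, r). [(0, i, p), (0, j, q), (i, (j + 4095 - i) mod 4095, r)])"

text \<open>The shift \<open>s\<close> cancels in ratios. The last three entries are the inverses of
  the first three; a zero exponent would give 4095 here, which \<open>admissible\<close>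
  rejects.\<close>

definition ratio_exps :: "nat \<times> nat \<times> nat \<Rightarrow> nat list" where
  "ratio_exps = (\<lambda>(s, e, z). let d = (e + 4095 - z) mod 4095
    in [e, z, d, 4095 - e, 4095 - z, 4095 - d])"

definition base_edges :: "(code \<times> nat \<times> nat \<times> nat) list" where
  "base_edges = concat (map (\<lambda>c. map (Pair c) (edges c)) base)"

text \<open>
  Distinctness is tested by splitting on binary digits, since the defining equations of
  \<^const>\<open>distinct\<close> need quadratically many comparisons.
\<close>

fun evens :: "num list \<Rightarrow> num list" where
  "evens [] = []"
| "evens (num.Bit0 n # ns) = n # evens ns"
| "evens (num.Bit1 n # ns) = evens ns"
| "evens (num.One # ns) = evens ns"

fun odds :: "num list \<Rightarrow> num list" where
  "odds [] = []"
| "odds (num.Bit0 n # ns) = odds ns"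
| "odds (num.Bit1 n # ns) = n # odds ns"
| "odds (num.One # ns) = odds ns"

fun ones :: "num list \<Rightarrow> num list" where
  "ones [] = []"
| "ones (num.Bit0 n # ns) = ones ns"
| "ones (num.Bit1 n # ns) = ones ns"
| "ones (num.One # ns) = num.One # ones ns"

fun at_most_one :: "'a list \<Rightarrow> bool" where
  "at_most_one [] = True"
| "at_most_one [n] = True"
| "at_most_one _ = False"

fun radix_distinct :: "nat \<Rightarrow> num list \<Rightarrow> bool" where
  "radix_distinct 0 ns = at_most_one ns"
| "radix_distinct (Suc k) ns =
    (at_most_one (ones ns) \<and> radix_distinct k (evens ns) \<and> radix_distinct k (odds ns))"

lemma set_parts:
  "num.Bit0 n \<in> set ns \<Longrightarrow> n \<in> set (evens ns)"
  "num.Bit1 n \<in> set ns \<Longrightarrow> n \<in> set (odds ns)"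
  "num.One \<in> set ns \<Longrightarrow> ones ns \<noteq> []"
  by (induction ns rule: evens.induct) auto

text \<open>Equal entries have the same last digit, so a repetition survives in one of the three
  parts.\<close>

lemma distinct_if_parts:
  "at_most_one (ones ns) \<Longrightarrow> distinct (evens ns) \<Longrightarrow> distinct (odds ns) \<Longrightarrow> distinct ns"
proof (induction ns rule: evens.induct)
  case (4 ns)
  then have "ones ns = []" by (cases "ones ns") auto
  with 4 show ?case using set_parts(3) by fastforce
qed (auto dest: set_parts)

text \<open>The depth \<open>k\<close> does not affect soundness: a value that is too small can only
  make the test fail. Numbers below 4096 have at most 12 binary digits.\<close>

lemma radix_distinct_imp_distinct: "radix_distinct k ns \<Longrightarrow> distinct ns"
proof (induction k ns rule: radix_distinct.induct)
  case (1 ns)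
  then show ?case by (cases ns rule: at_most_one.cases) auto
qed (auto intro: distinct_if_parts)

definition all_exps :: "nat list" where
  "all_exps = concat (map (\<lambda>(c, e). ratio_exps e) base_edges)"

fun admissible :: "nat list \<Rightarrow> bool" where
  "admissible [] = True"
| "admissible (n # ns) = (n < 4095 \<and> n mod 65 \<noteq> 0 \<and> admissible ns)"

lemma admissibleD: "admissible ns \<Longrightarrow> n \<in> set ns \<Longrightarrow> n < 4095 \<and> n mod 65 \<noteq> 0"
  by (induction ns) auto

text \<open>The length is tested here so that the list is evaluated only once.\<close>

definition all_distinct_4032 :: "nat list \<Rightarrow> bool" where
  "all_distinct_4032 ns \<longleftrightarrow> length ns = 4032 \<and> radix_distinct 12 (map num_of_nat ns)"

definition valid_code :: "code \<Rightarrow> bool" where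
  "valid_code = (\<lambda>(i, j, p, q, r). i < j \<and> j < 4095 \<and> p < 4095 \<and> p \<noteq> j \<and>
    zech i p \<and> zech j q \<and> zech (j - i) r)"

section \<open>Checks by evaluation\<close>

lemma valid_table: "list_all valid_code (base_long @ base_short)"
  by code_simp

lemma base_admissible: "list_all (\<lambda>c. admissible (concat (map ratio_exps (edges c)))) base"
  by code_simp

lemma all_distinct_4032_all_exps: "all_distinct_4032 all_exps"
  by code_simp

text \<open>The exponents are the maximal proper divisors of 4095; see \<open>power_g_eq_1_iff\<close>.\<close>

lemma zech_primes: "zech 1365 2730" "zech 819 3822" "zech 585 1755" "zech 315 3505"
  by code_simp+

lemma power_bits_4095: "power_bits (num_of_nat 4095) =
  (True, False, False, False, False, False, False, False, False, False, False, False)"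
  by code_simp

text \<open>Distinctness of all exponents thus means that an exponent determines the base edge it
  comes from.\<close>

lemma distinct_concat_mapD:
  "distinct (concat (map f xs)) \<Longrightarrow> x \<in> set xs \<Longrightarrow> y \<in> set xs \<Longrightarrow>
    n \<in> set (f x) \<Longrightarrow> n \<in> set (f y) \<Longrightarrow> x = y"
  by (induction xs) auto

lemma distinct_all_exps: "distinct all_exps"
  using all_distinct_4032_all_exps unfolding all_distinct_4032_def
  by (auto dest: radix_distinct_imp_distinct simp: distinct_map)

lemma mem_base_edges: "(c, e) \<in> set base_edges \<longleftrightarrow> c \<in> set base \<and> e \<in> set (edges c)"
  unfolding base_edges_def by auto

lemma all_exps_eq: "all_exps = concat (map (\<lambda>x. ratio_exps (snd x)) base_edges)"
  unfolding all_exps_def by (simp add: case_prod_beta')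

lemma mem_all_exps:
  "n \<in> set all_exps \<longleftrightarrow> (\<exists>c\<in>set base. \<exists>e\<in>set (edges c). n \<in> set (ratio_exps e))"
  unfolding all_exps_eq by (auto simp: mem_base_edges) (metis mem_base_edges snd_conv)+

lemma admissible_exps:
  assumes "c \<in> set base" "e \<in> set (edges c)" "n \<in> set (ratio_exps e)"
  shows "n < 4095 \<and> n mod 65 \<noteq> 0"
proof (rule admissibleD)
  show "admissible (concat (map ratio_exps (edges c)))"
    using base_admissible assms(1) unfolding list_all_iff by blast
qed (use assms(2,3) in auto)

text \<open>The list has 4032 distinct entries in a set of 4095 - 63 = 4032 elements, so the
  inclusion is an equality.\<close>

lemma set_all_exps: "set all_exps = {n. n < 4095 \<and> n mod 65 \<noteq> 0}" (is "_ = ?A")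
proof -
  have check: "length all_exps = 4032" "set all_exps \<subseteq> ?A" "distinct all_exps"
    using all_distinct_4032_all_exps distinct_all_exps mem_all_exps admissible_exps
    unfolding all_distinct_4032_def by blast+
  have "?A = {..<4095} - (\<lambda>k. 65 * k) ` {..<63}"
  proof (intro set_eqI iffI)
    fix n assume n: "n \<in> {..<4095::nat} - (\<lambda>k. 65 * k) ` {..<63}"
    have "n = 65 * (n div 65)" if "n mod 65 = 0"
      using that by presburger
    moreover have "n div 65 < 63" using n by (auto simp: less_mult_imp_div_less)
    ultimately show "n \<in> ?A" using n by blast
  qed auto
  moreover have "card ((\<lambda>k. 65 * k) ` {..<63::nat}) = 63"
    by (subst card_image) (auto simp: inj_on_def)
  moreover have "(\<lambda>k. 65 * k) ` {..<63} \<subseteq> {..<4095::nat}" by auto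
  ultimately have "card ?A = 4032"
    by (simp add: card_Diff_subset)
  then show ?thesis
    using check by (intro card_subset_eq) (auto simp: distinct_card)
qed

section \<open>A primitive root and the design\<close>

lemma modulus_dvd_power_4095:
  fixes x :: "'a::comm_ring_1"
  assumes "(2::'a) = 0"
  shows "modulus x dvd x ^ 4095 - 1"
proof -
  have "numeral (num_of_nat 4095) = (4095::nat)"
    by (rule numeral_num_of_nat) simp
  then show ?thesis
    using eval_power_bits[OF assms, of x "num_of_nat 4095"] unfolding power_bits_4095 by simp
qed

context field_4096
begin

lemma power_4095:
  fixes x :: 'f
  assumes "x \<noteq> 0"
  shows "x ^ 4095 = 1"
proof -
  have "card (UNIV - {0 :: 'f}) = 4095"
    using card_field by (simp add: card_Diff_singleton)
  then show ?thesis
    using power_card_eq_1[of "UNIV - {0}" x] assms by simp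
qed

text \<open>Every nonzero element is a root of \<open>X ^ 4095 - 1\<close>, a multiple of the
  modulus. If the modulus had no root, all 4095 would be roots of the cofactor \<open>q\<close>,
  whose degree is at most 4083.\<close>

lemma ex_modulus_root: "\<exists>g::'f. modulus g = 0"
proof (rule ccontr)
  assume no_root: "\<nexists>g::'f. modulus g = 0"
  define X where "X = (monom 1 1 :: 'f poly)"
  have X_power: "X ^ n = monom 1 n" for n
    unfolding X_def by (simp add: monom_power)
  have "(2 :: 'f poly) = 0"
    by (simp add: numeral_poly)
  then obtain q where q: "X ^ 4095 - 1 = modulus X * q"
    using modulus_dvd_power_4095 by (auto elim: dvdE)
  have eval_q: "poly q y = 0" if "y \<noteq> 0" for y
  proof -
    have "poly (X ^ 4095 - 1) y = 0"
      unfolding poly_diff X_power poly_monom using power_4095[OF that] by simp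
    moreover have "poly (modulus X) y = modulus y"
      unfolding modulus_def poly_add X_power poly_monom by (simp add: X_def poly_monom)
    ultimately show ?thesis
      using q no_root by simp
  qed
  have "poly (X ^ 4095 - 1) 0 \<noteq> 0"
    unfolding poly_diff X_power poly_monom by simp
  then have "X ^ 4095 - 1 \<noteq> 0" by force
  then have nz: "modulus X \<noteq> 0" "q \<noteq> 0" using q by auto
  have "coeff (modulus X) 12 = 1"
    unfolding modulus_def coeff_add X_power by (simp add: X_def)
  then have "12 \<le> degree (modulus X)"
    by (intro le_degree) simp
  moreover have "degree (X ^ 4095 - 1) \<le> 4095"
    unfolding X_power by (intro degree_diff_le) (auto simp: degree_monom_le)
  moreover have "degree (X ^ 4095 - 1) = degree (modulus X) + degree q"
    unfolding q using nz by (rule degree_mult_eq)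
  moreover have "card {y. poly q y = 0} \<le> degree q"
    using nz by (intro card_poly_roots_bound)
  moreover have "card (UNIV - {0 :: 'f}) \<le> card {y. poly q y = 0}"
    using eval_q by (intro card_mono) auto
  moreover have "card (UNIV - {0 :: 'f}) = 4095"
    using card_field by (simp add: card_Diff_singleton)
  ultimately show False by linarith
qed

end

section \<open>Powers of a primitive root\<close>

locale primitive_root_4096 = field_4096 K for K :: "'a::{field, finite} set" +
  fixes g :: 'a
  assumes modulus_g: "modulus g = 0"
begin

lemma g_nonzero [simp]: "g \<noteq> 0"
  using modulus_g by (auto simp: modulus_def)

lemma g_4095: "g ^ 4095 = 1"
  using power_4095 by simp

lemma zech_g: "zech e z \<Longrightarrow> 1 + g ^ e = g ^ z"
  using zech_sound[OF two_eq_0 modulus_g] .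

text \<open>Otherwise the power \<open>g ^ z\<close> would be 1 + 1 = 0.\<close>

lemma zech_g_neq_1: "zech e z \<Longrightarrow> g ^ e \<noteq> 1"
  using zech_g[of e z] by auto

text \<open>The order \<open>d\<close> of \<open>g\<close> divides 4095. Were it a proper divisor,
  \<open>g ^ (4095 div p)\<close> would be 1 for a prime \<open>p\<close> among 3, 5, 7, 13, against
  \<open>zech_primes\<close>.\<close>

lemma power_g_eq_1_iff: "g ^ n = 1 \<longleftrightarrow> 4095 dvd n"
proof -
  define d where "d = (LEAST d. 0 < d \<and> g ^ d = 1)"
  have d: "0 < d \<and> g ^ d = 1"
    unfolding d_def using g_4095 by (intro LeastI[of "\<lambda>d. 0 < d \<and> g ^ d = 1" 4095]) simp
  have d_dvd: "d dvd n" if "g ^ n = 1" for n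
  proof (rule ccontr)
    assume "\<not> d dvd n"
    then have "0 < n mod d" by (simp add: dvd_eq_mod_eq_0)
    moreover have "g ^ n = (g ^ d) ^ (n div d) * g ^ (n mod d)"
      by (simp flip: power_mult power_add)
    then have "g ^ (n mod d) = 1" using that d by simp
    ultimately have "d \<le> n mod d"
      unfolding d_def by (intro Least_le) simp
    moreover have "n mod d < d" using d by simp
    ultimately show False by simp
  qed
  obtain k where k: "4095 = d * k"
    using d_dvd[OF g_4095] by blast
  have "k = 1"
  proof (rule ccontr)
    assume "k \<noteq> 1"
    then obtain p where p: "prime p" "p dvd k"
      using prime_factor_nat by blast
    then obtain l where "k = p * l" by (elim dvdE)
    then have l: "4095 = p * (d * l)"
      using k by (simp add: ac_simps)
    have "g ^ (d * l) = 1" using d by (simp add: power_mult)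
    \<comment> \<open>This is the factorization of 4095.\<close>
    have "p dvd 3 * (3 * (5 * (7 * 13)))" using l by (intro dvdI[of _ _ "d * l"]) simp
    then have "p dvd 3 \<or> p dvd 5 \<or> p dvd 7 \<or> p dvd 13"
      using prime_dvd_multD[OF p(1)] by blast
    moreover have "prime (3::nat)" "prime (5::nat)" "prime (7::nat)" "prime (13::nat)"
      by simp_all
    ultimately have "p \<in> {3, 5, 7, 13}"
      using primes_dvd_imp_eq[OF p(1)] by blast
    then have "d * l \<in> {1365, 819, 585, 315}"
      using l by auto
    then show False
      using \<open>g ^ (d * l) = 1\<close> zech_primes zech_g_neq_1 by auto
  qed
  then have "d = 4095" using k by simp
  then show ?thesis
    using d_dvd d by (auto simp: power_mult elim!: dvdE)
qed

lemma power_g_mod: "g ^ (n mod 4095) = g ^ n"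
proof -
  have "g ^ n = (g ^ 4095) ^ (n div 4095) * g ^ (n mod 4095)"
    by (simp only: power_mult[symmetric] power_add[symmetric] mult_div_mod_eq)
  then show ?thesis by (simp only: g_4095 power_one mult_1)
qed

lemma power_g_inj:
  assumes "g ^ m = g ^ n" "m < 4095" "n < 4095"
  shows "m = n"
  using assms
proof (induction m n rule: linorder_wlog)
  case (le m n)
  have "g ^ n = g ^ m * g ^ (n - m)"
    using le(1) by (simp only: power_add[symmetric] le_add_diff_inverse)
  then have "g ^ (n - m) = 1" using le(2) by simp
  then have "4095 dvd n - m" using power_g_eq_1_iff by simp
  then show ?case using le by (auto dest: dvd_imp_le)
qed auto

lemma ex_power_g:
  assumes "x \<noteq> 0"
  obtains n where "n < 4095" "x = g ^ n"
proof -
  have "card ((\<lambda>n. g ^ n) ` {..<4095}) = card {..<4095::nat}"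
    by (intro card_image inj_onI) (auto dest: power_g_inj)
  moreover have "card (UNIV - {0 :: 'a}) = 4095"
    using card_field by (simp add: card_Diff_singleton)
  ultimately have "(\<lambda>n. g ^ n) ` {..<4095} = UNIV - {0}"
    by (intro card_subset_eq) auto
  then show ?thesis using assms that by blast
qed

text \<open>The nonzero elements of \<open>K\<close> are the solutions of \<open>x ^ 63 = 1\<close>,
  and 4095 = 65 * 63.\<close>

lemma power_g_in_K_iff: "g ^ n \<in> K \<longleftrightarrow> 65 dvd n"
proof
  assume "g ^ n \<in> K"
  then have "g ^ (n * 63) = 1"
    using power_63[of "g ^ n"] unfolding power_mult by simp
  then have "65 * 63 dvd n * 63"
    unfolding power_g_eq_1_iff by simp
  then show "65 dvd n" by (subst (asm) dvd_times_right_cancel_iff) simp_all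
next
  assume "65 dvd n"
  then have "4095 dvd n * 63" by (auto elim!: dvdE)
  then have "(g ^ n) ^ 63 = 1"
    unfolding power_mult[symmetric] power_g_eq_1_iff .
  then show "g ^ n \<in> K" by (rule in_K_if_power_63)
qed

text \<open>Adding 4095 first keeps the subtraction of natural numbers from truncating.\<close>

lemma power_g_diff:
  assumes "n \<le> 4095"
  shows "g ^ ((m + 4095 - n) mod 4095) = g ^ m / g ^ n"
proof -
  have "m + 4095 - n = m + (4095 - n)" using assms by simp
  then have "g ^ ((m + 4095 - n) mod 4095) = g ^ m * g ^ (4095 - n)"
    by (simp only: power_g_mod power_add)
  also have "g ^ (4095 - n) = 1 / g ^ n"
    using assms by (simp add: power_diff g_4095)
  finally show ?thesis by simp
qed

lemma power_g_neg:
  assumes "n \<le> 4095"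
  shows "g ^ (4095 - n) = 1 / g ^ n"
  using assms by (simp add: power_diff g_4095)

section \<open>The base triangles in the field\<close>

definition line :: "nat \<times> nat \<times> nat \<Rightarrow> 'a set" where
  "line = (\<lambda>(s, e, z). (*) (g ^ s) ` {0, 1, g ^ e, g ^ z})"

definition triangle :: "code \<Rightarrow> 'a set set" where
  "triangle c = line ` set (edges c)"

text \<open>Reduction modulo 4095 may destroy \<open>i < j\<close>, so the third relation uses the
  quotient \<open>g ^ j / g ^ i\<close>. The last conjunct keeps the vertex \<open>g ^ j\<close> off
  the line through 1 and \<open>g ^ i\<close>.\<close>

definition sound :: "code \<Rightarrow> bool" where
  "sound = (\<lambda>(i, j, p, q, r). i < 4095 \<and> j < 4095 \<and> p < 4095 \<and> q < 4095 \<and> r < 4095 \<and>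
    1 + g ^ i = g ^ p \<and> 1 + g ^ j = g ^ q \<and> 1 + g ^ j / g ^ i = g ^ r \<and> g ^ p \<noteq> g ^ j)"

lemma power_2_power_add: "(x + y) ^ 2 ^ k = x ^ 2 ^ k + (y ^ 2 ^ k :: 'a)"
  by (induction k) (simp_all add: power_mult square_add[OF two_eq_0] mult.commute[of 2])

text \<open>The relations survive raising to the power \<open>2 ^ k\<close>, which is additive and
  injective. Hence only the orbit representatives need the evaluated check
  \<open>valid_table\<close>.\<close>

lemma sound_frobenius:
  assumes "valid_code c"
  shows "sound (frobenius (2 ^ k) c)"
proof -
  obtain i j p q r where c: "c = (i, j, p, q, r)" by (metis prod.exhaust)
  have v: "i < j" "j < 4095" "p < 4095" "p \<noteq> j" "zech i p" "zech j q" "zech (j - i) r"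
    using assms unfolding c valid_code_def by auto
  have pw: "g ^ (2 ^ k * n mod 4095) = (g ^ n) ^ 2 ^ k" for n
    by (simp add: power_g_mod mult.commute flip: power_mult)
  have one: "1 + x ^ 2 ^ k = (1 + x) ^ 2 ^ k" for x :: 'a
    by (simp add: power_2_power_add)
  have "1 + g ^ j / g ^ i = g ^ r"
    using zech_g[OF v(7)] v(1) by (simp add: power_diff)
  moreover have "(g ^ p) ^ 2 ^ k \<noteq> (g ^ j) ^ 2 ^ k"
  proof
    assume "(g ^ p) ^ 2 ^ k = (g ^ j) ^ 2 ^ k"
    then have "(g ^ p + g ^ j) ^ 2 ^ k = 0"
      by (simp add: power_2_power_add)
    then have "g ^ p = g ^ j" by (simp add: add_eq_0_iff_eq)
    then show False using power_g_inj v by blast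
  qed
  ultimately show ?thesis
    unfolding c sound_def frobenius_def
    by (simp add: pw one zech_g[OF v(5)] zech_g[OF v(6)] flip: power_divide)
qed

lemma sound_base:
  assumes "c \<in> set base"
  shows "sound c"
proof -
  have "set base \<subseteq> (\<Union>m\<in>{1, 8, 64, 512}. frobenius m ` set (base_long @ base_short))"
    unfolding base_def set_append set_concat set_map image_Un by auto
  then obtain m b where "m \<in> {1, 8, 64, 512}" "b \<in> set (base_long @ base_short)" "c = frobenius m b"
    using assms by blast
  then have "m \<in> {2 ^ 0, 2 ^ 3, 2 ^ 6, 2 ^ 9}" by simp
  then obtain k where "m = 2 ^ k" by blast
  moreover have "valid_code b"
    using valid_table \<open>b \<in> set (base_long @ base_short)\<close> unfolding list_all_iff by (rule bspec)
  ultimately show ?thesis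
    using sound_frobenius \<open>c = frobenius m b\<close> by simp
qed

lemma triangle_eq_span:
  assumes "sound (i, j, p, q, r)"
  shows "triangle (i, j, p, q, r) = {span {1, g ^ i}, span {g ^ i, g ^ j}, span {g ^ j, 1}}"
proof -
  have "i < 4095" "g ^ i * (g ^ j / g ^ i) = g ^ j"
    "g ^ p = 1 + g ^ i" "g ^ q = 1 + g ^ j" "g ^ r = 1 + g ^ j / g ^ i"
    using assms unfolding sound_def by auto
  then show ?thesis
    unfolding triangle_def edges_def line_def
    by (simp add: span_pair power_g_diff distrib_left insert_commute add.commute)
qed

lemma is_triangle_base:
  assumes "c \<in> set base"
  shows "is_triangle (triangle c)"
proof -
  obtain i j p q r where c: "c = (i, j, p, q, r)" by (metis prod.exhaust)
  have s: "sound (i, j, p, q, r)" using sound_base assms c by simp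
  then have *: "1 + g ^ i = g ^ p" "1 + g ^ j = g ^ q" "1 + g ^ j / g ^ i = g ^ r" "g ^ p \<noteq> g ^ j"
    unfolding sound_def by auto
  \<comment> \<open>Two equal vertices would make one of \<open>g ^ p\<close>, \<open>g ^ q\<close>,
    \<open>g ^ r\<close> equal to 1 + 1 = 0.\<close>
  then have neq: "1 \<noteq> g ^ i" "g ^ i \<noteq> g ^ j" "g ^ j \<noteq> 1"
    using add_self[of 1] by (auto simp del: add_self)
  moreover have "1 \<noteq> g ^ i + g ^ j"
    using * by (metis add.commute add_eq_iff)
  ultimately have "independent {1, g ^ i, g ^ j}"
    by (intro independent_tripleI) auto
  then show ?thesis
    unfolding c triangle_eq_span[OF s] is_triangle_def using neq
    by (intro exI[of _ 1] exI[of _ "g ^ i"] exI[of _ "g ^ j"]) simp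
qed

lemma edge_base:
  assumes "c \<in> set base" "(s, e, z) \<in> set (edges c)"
  shows "e < 4095" "z < 4095" "1 + g ^ e = g ^ z"
proof -
  obtain i j p q r where c: "c = (i, j, p, q, r)" by (metis prod.exhaust)
  have "sound (i, j, p, q, r)" using sound_base assms(1) c by simp
  then show "e < 4095" "z < 4095" "1 + g ^ e = g ^ z"
    using assms(2) unfolding c sound_def edges_def by (auto simp: power_g_diff)
qed

lemma ratios_line:
  assumes "c \<in> set base" "e \<in> set (edges c)"
  shows "ratios (line e) = (\<lambda>n. g ^ n) ` set (ratio_exps e)"
proof -
  obtain s a z where e: "e = (s, a, z)" by (metis prod.exhaust)
  note * = edge_base[OF assms(1) assms(2)[unfolded e]]
  define t w where "t = g ^ a" and "w = g ^ z"
  \<comment> \<open>Since \<open>1 + t = w\<close> with \<open>t\<close> and \<open>w\<close>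
    nonzero, no two of 1, \<open>t\<close>, \<open>w\<close> agree.\<close>
  have nz: "t \<noteq> 0" "w \<noteq> 0" "t \<noteq> 1" "w \<noteq> 1" "t \<noteq> w"
    using *(3) unfolding t_def[symmetric] w_def[symmetric]
    by (auto simp: t_def w_def)
  have "ratios (line e) = ratios {0, 1, t, w}"
    unfolding e line_def t_def w_def by (simp only: prod.case) (rule ratios_mult, simp)
  also have "\<dots> = {t, w, t / w, 1 / t, 1 / w, w / t}"
  proof
    show "ratios {0, 1, t, w} \<subseteq> {t, w, t / w, 1 / t, 1 / w, w / t}"
      unfolding ratios_def by auto
    have "y / x \<in> ratios {0, 1, t, w}" if "x \<in> {1, t, w}" "y \<in> {1, t, w}" "x \<noteq> y" for x y
      unfolding ratios_def by (rule CollectI, rule exI[of _ x], rule exI[of _ y]) (use that nz in auto)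
    from this[of 1 t] this[of 1 w] this[of w t] this[of t 1] this[of w 1] this[of t w]
    show "{t, w, t / w, 1 / t, 1 / w, w / t} \<subseteq> ratios {0, 1, t, w}"
      using nz by simp
  qed
  also have "\<dots> = (\<lambda>n. g ^ n) ` set (ratio_exps e)"
  proof -
    have "g ^ (4095 - (a + 4095 - z) mod 4095) = w / t"
      using *(1,2) power_g_diff[of z a] by (simp add: power_g_neg t_def w_def)
    then show ?thesis
      using *(1,2) by (simp add: e ratio_exps_def Let_def t_def w_def power_g_diff power_g_neg)
  qed
  finally show ?thesis .
qed

lemma balanced_design_base:
  "balanced_group_divisible_triangle_design F2_scale 12 6 (one_dim_subspaces K)
    (translates (triangle ` set base))"
proof (rule balanced_design_translates)
  fix T assume "T \<in> triangle ` set base"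
  then show "is_triangle T" using is_triangle_base by blast
next
  fix T U assume TU: "T \<in> triangle ` set base" "U \<in> T"
  then obtain c e where ce: "c \<in> set base" "e \<in> set (edges c)" "T = triangle c" "U = line e"
    unfolding triangle_def by blast
  have "subspace U \<and> dim U = 2"
    using triangle_line is_triangle_base TU ce by blast
  moreover have "g ^ n \<notin> K" if "n \<in> set (ratio_exps e)" for n
  proof -
    \<comment> \<open>The exponents that occur are not divisible by 65, so no ratio lies in
      \<open>K\<close>; below, the converse inclusion in \<open>set_all_exps\<close> gives the
      covering.\<close>
    have "n \<in> set all_exps" using that ce mem_all_exps by blast
    then show ?thesis
      unfolding set_all_exps power_g_in_K_iff by (simp add: dvd_eq_mod_eq_0)
  qed
  ultimately show "subspace U \<and> dim U = 2 \<and> ratios U \<inter> K = {}"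
    using ratios_line[OF ce(1,2)] ce(4) by auto
next
  fix r assume r: "r \<notin> K"
  then have "r \<noteq> 0" using zero_in_K by blast
  then obtain n where n: "n < 4095" "r = g ^ n" by (rule ex_power_g)
  then have "n \<in> set all_exps"
    using r power_g_in_K_iff[of n] unfolding set_all_exps by (auto simp: dvd_eq_mod_eq_0)
  then obtain c e where "c \<in> set base" "e \<in> set (edges c)" "n \<in> set (ratio_exps e)"
    by (auto simp only: mem_all_exps)
  then have "r \<in> ratios (line e)" "line e \<in> triangle c"
    using n(2) ratios_line unfolding triangle_def by auto
  then show "\<exists>T\<in>triangle ` set base. \<exists>U\<in>T. r \<in> ratios U"
    using \<open>c \<in> set base\<close> by blast
next
  fix r T U T' U'
  assume "T \<in> triangle ` set base" "U \<in> T" "T' \<in> triangle ` set base" "U' \<in> T'"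
    and r: "r \<in> ratios U" "r \<in> ratios U'"
  then obtain c e c' e' where ce: "c \<in> set base" "e \<in> set (edges c)" "T = triangle c" "U = line e"
    and ce': "c' \<in> set base" "e' \<in> set (edges c')" "T' = triangle c'" "U' = line e'"
    unfolding triangle_def by blast
  obtain n n' where n: "n \<in> set (ratio_exps e)" "r = g ^ n"
    and n': "n' \<in> set (ratio_exps e')" "r = g ^ n'"
    using r ratios_line[OF ce(1,2)] ratios_line[OF ce'(1,2)] ce(4) ce'(4) by auto
  have "n \<in> set all_exps" "n' \<in> set all_exps"
    using mem_all_exps ce ce' n n' by blast+
  then have "n = n'"
    using power_g_inj n n' unfolding set_all_exps by auto
  \<comment> \<open>A common exponent would occur twice in \<open>all_exps\<close> if the two base
    edges differed.\<close>
  then have "(c, e) = (c', e')"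
    using distinct_concat_mapD[OF distinct_all_exps[unfolded all_exps_eq], of "(c, e)" "(c', e')" n]
      ce ce' n n' by (simp add: mem_base_edges)
  then show "T = T' \<and> U = U'" using ce ce' by simp
qed

end

theorem theorem3:
  fixes K :: "'f::{field, finite} set"
  assumes "CARD('f) = 2 ^ 12"
    and "is_subfield K"
    and "card K = 2 ^ 6"
  shows "card (one_dim_subspaces K) = 65 \<and>
    (\<exists>\<B> :: 'f set set set.
      balanced_group_divisible_triangle_design F2_scale 12 6 (one_dim_subspaces K) \<B> \<and>
      (\<forall>u. u \<noteq> 0 \<longrightarrow> mult_triangle u ` \<B> = \<B>))"
proof -
  interpret field_4096 K
    by unfold_locales (fact assms)+
  obtain g :: 'f where g: "modulus g = 0"
    using ex_modulus_root by blast
  interpret primitive_root_4096 K g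
    by unfold_locales (fact g)
  show ?thesis
    using card_one_dim_subspaces balanced_design_base mult_triangle_translates by blast
qed

end
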